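(* Let $C\subseteq\mathcal H$ be nonempty, closed and convex, and for each $k=0,1,2,\ldots$, let $U_k\colon\mathcal H\to\mathcal H$ be $\rho_k$-strongly quasi-nonexpansive with $\rho:=\inf_k\rho_k>0$ and $C\subseteq F:=\bigcap_{k=0}^\infty\operatorname{Fix}U_k$. Let $x^0\in\mathcal H$ and for each $k=0,1,2,\ldots$, let $x^{k+1}:=U_kx^k$. (i) If $\{U_k\}_{k=0}^\infty$ is weakly $C$-regular, then $x^k$ converges weakly to some $x^*\in C$. (ii) If $\{U_k\}_{k=0}^\infty$ is boundedly $C$-regular, then $x^k$ converges in norm to some $x^*\in C$. (iii) If $\{U_k\}_{k=0}^\infty$ is boundedly linearly $C$-regular, then $x^k$ converges $R$-linearly to some $x^*\in C$, that is, $\|x^k-x^*\|\le 2d(x^0,C)q^k$, $k=0,1,2,\ldots$, for some $q\in(0,1)$.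
   Context: $\mathcal H$ is a real Hilbert space, $\operatorname{Fix}U:=\{x\in\mathcal H\mid Ux=x\}$, and $d(x,C):=\inf_{y\in C}\|x-y\|$. For $\rho\ge 0$, an operator $T\colon\mathcal H\to\mathcal H$ is $\rho$-strongly quasi-nonexpansive if $\operatorname{Fix}T\ne\emptyset$ and $\|Tu-z\|^2\le\|u-z\|^2-\rho\|Tu-u\|^2$ for all $u\in\mathcal H$, $z\in\operatorname{Fix}T$; it is quasi-nonexpansive if this holds with $\rho=0$. Let $D\subseteq\mathcal H$ be nonempty, closed and convex. A sequence $\{V_k\}_{k=0}^\infty$ of quasi-nonexpansive operators $V_k\colon\mathcal H\to\mathcal H$ is: (a) weakly $D$-regular if for every sequence $\{x^k\}_{k=0}^\infty\subseteq\mathcal H$ and every strictly increasing sequence $\{n_k\}$ of nonnegative integers, $x^{n_k}\rightharpoonup y$ (weakly, as $k\to\infty$) and $\|V_kx^k-x^k\|\to 0$ imply $y\in D$; (b) boundedly $D$-regular if for every bounded sequence $\{x^k\}_{k=0}^\infty\subseteq\mathcal H$, $\|V_kx^k-x^k\|\to 0$ implies $d(x^k,D)\to 0$; (c) boundedly linearly $D$-regular if for every nonempty bounded $S\subseteq\mathcal H$ there is $\delta>0$ (depending on $S$) such that $d(x,D)\le\delta\|V_kx-x\|$ for all $x\in S$ and all $k=0,1,2,\ldots$. *)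

theory Defs
  imports "HOL-Analysis.Analysis"
begin

text \<open>A real Hilbert space is a type of sort \<open>{real_inner, complete_space}\<close>. The distance
  \<open>d(x, D)\<close> is \<open>infdist x D\<close>, which is the infimum of \<open>dist x y\<close> over \<open>y \<in> D\<close> for nonempty \<open>D\<close>.\<close>

definition Fix :: "('a \<Rightarrow> 'a) \<Rightarrow> 'a set" where
  "Fix T = {x. T x = x}"

text \<open>Weak convergence is tested against the functionals \<open>inner _ y\<close>; by Riesz representation these
  are all the continuous linear functionals on a Hilbert space.\<close>

definition weakly_converges ::
  "(nat \<Rightarrow> 'a::{real_inner, complete_space}) \<Rightarrow> 'a \<Rightarrow> bool" where
  "weakly_converges x l \<longleftrightarrow> (\<forall>y. (\<lambda>k. inner (x k) y) \<longlonglongrightarrow> inner l y)"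

definition strongly_quasi_nonexpansive ::
  "real \<Rightarrow> ('a::{real_inner, complete_space} \<Rightarrow> 'a) \<Rightarrow> bool" where
  "strongly_quasi_nonexpansive \<rho> T \<longleftrightarrow>
     \<rho> \<ge> 0 \<and> Fix T \<noteq> {} \<and>
     (\<forall>u. \<forall>z\<in>Fix T. (norm (T u - z))\<^sup>2 \<le> (norm (u - z))\<^sup>2 - \<rho> * (norm (T u - u))\<^sup>2)"

definition quasi_nonexpansive :: "('a::{real_inner, complete_space} \<Rightarrow> 'a) \<Rightarrow> bool" where
  "quasi_nonexpansive T \<longleftrightarrow> strongly_quasi_nonexpansive 0 T"

text \<open>The three regularity notions below are only meant for nonempty closed convex \<open>D\<close> and sequences
  of quasi-nonexpansive operators; this standing assumption is part of each definition.\<close>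

definition regularity_setting ::
  "'a::{real_inner, complete_space} set \<Rightarrow> (nat \<Rightarrow> 'a \<Rightarrow> 'a) \<Rightarrow> bool" where
  "regularity_setting D V \<longleftrightarrow>
     D \<noteq> {} \<and> closed D \<and> convex D \<and> (\<forall>k. quasi_nonexpansive (V k))"

definition weakly_regular ::
  "'a::{real_inner, complete_space} set \<Rightarrow> (nat \<Rightarrow> 'a \<Rightarrow> 'a) \<Rightarrow> bool" where
  "weakly_regular D V \<longleftrightarrow> regularity_setting D V \<and>
     (\<forall>(x :: nat \<Rightarrow> 'a) (n :: nat \<Rightarrow> nat) y.
        strict_mono n \<longrightarrow> weakly_converges (\<lambda>k. x (n k)) y \<longrightarrow>
        (\<lambda>k. norm (V k (x k) - x k)) \<longlonglongrightarrow> 0 \<longrightarrow> y \<in> D)"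

definition boundedly_regular ::
  "'a::{real_inner, complete_space} set \<Rightarrow> (nat \<Rightarrow> 'a \<Rightarrow> 'a) \<Rightarrow> bool" where
  "boundedly_regular D V \<longleftrightarrow> regularity_setting D V \<and>
     (\<forall>x :: nat \<Rightarrow> 'a. bounded (range x) \<longrightarrow>
        (\<lambda>k. norm (V k (x k) - x k)) \<longlonglongrightarrow> 0 \<longrightarrow> (\<lambda>k. infdist (x k) D) \<longlonglongrightarrow> 0)"

definition boundedly_linearly_regular ::
  "'a::{real_inner, complete_space} set \<Rightarrow> (nat \<Rightarrow> 'a \<Rightarrow> 'a) \<Rightarrow> bool" where
  "boundedly_linearly_regular D V \<longleftrightarrow> regularity_setting D V \<and>
     (\<forall>S. S \<noteq> {} \<longrightarrow> bounded S \<longrightarrow>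
        (\<exists>\<delta>>0. \<forall>x\<in>S. \<forall>k. infdist x D \<le> \<delta> * norm (V k x - x)))"

end

theory Submission
  imports Defs "HOL-Complex_Analysis.Great_Picard"
begin

text \<open>
  Everything rests on the inequality that strong quasi-nonexpansiveness gives along the orbit:
  for \<open>z \<in> C\<close> and \<open>r = inf \<rho>\<close>,
  \<open>\<parallel>x (k+1) - z\<parallel>\<^sup>2 \<le> \<parallel>x k - z\<parallel>\<^sup>2 - r \<parallel>x (k+1) - x k\<parallel>\<^sup>2\<close>.
  So the distance of \<open>x k\<close> to each point of \<open>C\<close> decreases (the orbit is Fejer monotone with respect
  to \<open>C\<close>), and since it converges, the steps \<open>x (k+1) - x k\<close> tend to \<open>0\<close>. Each of the
  regularity hypotheses can therefore be applied to the orbit itself.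

  Weak convergence: the orbit is bounded, so it has weakly convergent subsequences
  (\<open>bounded_weakly_convergent_subsequence\<close>), and regularity puts their limits in \<open>C\<close>. Two such
  limits \<open>y\<close>, \<open>y'\<close> agree, because \<open>\<parallel>x k - y\<parallel>\<^sup>2 - \<parallel>x k - y'\<parallel>\<^sup>2\<close> converges and is affine in \<open>x k\<close>,
  so \<open>inner (x k) (y - y')\<close> has the same limit along both subsequences (\<open>fejer_weak_limit_unique\<close>).
  A bounded sequence with only one weak subsequential limit converges weakly to it.

  Norm convergence: by monotonicity, comparing \<open>x m\<close> and \<open>x n\<close> with the point of \<open>C\<close> nearest
  to \<open>x n\<close> gives \<open>\<parallel>x m - x n\<parallel> \<le> 2 d(x n, C)\<close> for \<open>m \<ge> n\<close>. Once \<open>d(x n, C)\<close> tends to \<open>0\<close>,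
  the orbit is Cauchy and its limit \<open>x\<^sup>*\<close> satisfies \<open>\<parallel>x n - x\<^sup>*\<parallel> \<le> 2 d(x n, C)\<close>
  (\<open>fejer_norm_limit\<close>). Under bounded linear regularity the displayed inequality, with \<open>z\<close> the
  point of \<open>C\<close> nearest to \<open>x k\<close>, turns into a geometric decay of \<open>d(x k, C)\<close>, which yields the
  rate.

  The Hilbert space facts behind this (nearest points, orthogonal projections, and weak sequential
  compactness of bounded sequences) all come from one completeness argument,
  \<open>nested_closed_convex_inter\<close>.
\<close>

section \<open>Closed convex sets in Hilbert space\<close>

text \<open>The distances \<open>d n\<close> from \<open>p\<close> to \<open>K n\<close> increase to a limit. Choose points of the sets that
  almost realise these distances. The midpoint of two such points chosen after stage \<open>n\<close> lies in
  \<open>K n\<close>, so it is at distance at least \<open>d n\<close> from \<open>p\<close>, and the parallelogram law forces the two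
  points to be close to each other. The bound on the distance of the common point to \<open>p\<close> is what
  makes a constant sequence of sets yield nearest points.\<close>

lemma nested_closed_convex_inter:
  fixes K :: "nat \<Rightarrow> 'a::{real_inner, complete_space} set"
  assumes "decseq K" and ne: "\<And>n. K n \<noteq> {}" and "\<And>n. closed (K n)" and "\<And>n. convex (K n)"
    and bd: "\<And>n. infdist p (K n) \<le> B"
  shows "\<exists>u. (\<forall>n. u \<in> K n) \<and> dist p u \<le> B"
proof -
  define d where "d n = infdist p (K n)" for n
  have "incseq d"
    unfolding d_def using \<open>decseq K\<close> ne by (auto simp: incseq_def decseq_def intro!: infdist_mono)
  then obtain L where L: "d \<longlonglongrightarrow> L" and dL: "\<And>n. d n \<le> L"
    using incseq_convergent[of d B] bd d_def by auto
  have LB: "L \<le> B"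
    using LIMSEQ_le_const2[OF L] bd d_def by auto
  have "\<exists>u. u \<in> K n \<and> dist p u < L + 1 / real (Suc n)" for n
  proof -
    have "Inf (dist p ` K n) < L + 1 / real (Suc n)"
      using dL[of n] ne[of n] unfolding d_def infdist_def
      by (smt (verit) divide_pos_pos of_nat_0_less_iff zero_less_Suc)
    then show ?thesis
      using ne[of n] by (subst (asm) cInf_less_iff) (auto intro!: bdd_belowI[of _ 0])
  qed
  then obtain u where u: "\<And>n. u n \<in> K n" and pu: "\<And>n. dist p (u n) < L + 1 / real (Suc n)"
    by metis
  have uK: "u m \<in> K n" if "n \<le> m" for m n
    using u[of m] \<open>decseq K\<close> that by (auto simp: decseq_def)
  define e where "e n = 4 * ((L + 1 / real (Suc n))\<^sup>2 - (d n)\<^sup>2)" for n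
  have lim_inv: "(\<lambda>n. L + 1 / real (Suc n)) \<longlonglongrightarrow> L"
    using tendsto_add[OF tendsto_const LIMSEQ_inverse_real_of_nat, of L]
    by (simp add: inverse_eq_divide)
  have "e \<longlonglongrightarrow> 4 * (L\<^sup>2 - L\<^sup>2)"
    unfolding e_def by (intro tendsto_intros lim_inv L)
  then have e0: "e \<longlonglongrightarrow> 0" by simp
  have close: "(dist (u m) (u n))\<^sup>2 \<le> e n" if "n \<le> m" for m n
  proof -
    have "(1/2) *\<^sub>R u m + (1/2) *\<^sub>R u n \<in> K n"
      using assms(4)[of n] uK[OF that] u[of n] by (intro convexD) auto
    then have "d n \<le> dist p ((1/2) *\<^sub>R u m + (1/2) *\<^sub>R u n)"
      unfolding d_def by (rule infdist_le)
    then have mid: "(d n)\<^sup>2 \<le> (dist p ((1/2) *\<^sub>R u m + (1/2) *\<^sub>R u n))\<^sup>2"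
      by (intro power_mono) (auto simp: d_def infdist_nonneg)
    have par: "(dist (u m) (u n))\<^sup>2 = 2 * (dist p (u m))\<^sup>2 + 2 * (dist p (u n))\<^sup>2
        - 4 * (dist p ((1/2) *\<^sub>R u m + (1/2) *\<^sub>R u n))\<^sup>2"
      unfolding dist_norm power2_norm_eq_inner
      by (simp add: inner_add inner_diff inner_commute algebra_simps)
    have "1 / real (Suc m) \<le> 1 / real (Suc n)"
      using that by (simp add: frac_le)
    then have "dist p (u m) \<le> L + 1 / real (Suc n)" "dist p (u n) \<le> L + 1 / real (Suc n)"
      using pu[of m] pu[of n] by linarith+
    then have "(dist p (u m))\<^sup>2 \<le> (L + 1 / real (Suc n))\<^sup>2" "(dist p (u n))\<^sup>2 \<le> (L + 1 / real (Suc n))\<^sup>2"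
      by (auto intro!: power_mono)
    then show ?thesis
      using mid par unfolding e_def by argo
  qed
  have "Cauchy u"
  proof (rule metric_CauchyI)
    fix \<epsilon> :: real assume "\<epsilon> > 0"
    then have "\<forall>\<^sub>F n in sequentially. e n < (\<epsilon>/2)\<^sup>2"
      by (intro order_tendstoD(2)[OF e0]) auto
    then obtain N where N: "e N < (\<epsilon>/2)\<^sup>2"
      by (auto simp: eventually_sequentially)
    have "dist (u m) (u N) < \<epsilon>/2" if "N \<le> m" for m
      using close[OF that] N \<open>\<epsilon> > 0\<close> by (intro power2_less_imp_less[of "dist (u m) (u N)"]) auto
    then have "dist (u m) (u n) < \<epsilon>" if "N \<le> m" "N \<le> n" for m n
      using that by (blast intro: dist_triangle_half_r[of "u N"] dest: dist_commute_lessI)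
    then show "\<exists>M. \<forall>m\<ge>M. \<forall>n\<ge>M. dist (u m) (u n) < \<epsilon>"
      by blast
  qed
  then obtain v where v: "u \<longlonglongrightarrow> v"
    using Cauchy_convergent convergent_def by blast
  have "v \<in> K n" for n
    using closed_sequentially[OF assms(3)[of n], of "\<lambda>k. u (k + n)" v]
      uK[of n] LIMSEQ_ignore_initial_segment[OF v, of n] by auto
  moreover have "dist p v \<le> L"
  proof (rule LIMSEQ_le)
    show "(\<lambda>n. dist p (u n)) \<longlonglongrightarrow> dist p v"
      by (intro tendsto_intros v)
    show "\<exists>N. \<forall>n\<ge>N. dist p (u n) \<le> L + 1 / real (Suc n)"
      using pu less_imp_le by blast
  qed (rule lim_inv)
  ultimately show ?thesis
    using LB by force
qed

lemma nearest_point_exists: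
  fixes K :: "'a::{real_inner, complete_space} set"
  assumes "K \<noteq> {}" "closed K" "convex K"
  obtains u where "u \<in> K" "dist p u = infdist p K"
proof -
  obtain u where "u \<in> K" "dist p u \<le> infdist p K"
    using nested_closed_convex_inter[of "\<lambda>_. K" p "infdist p K"] assms by (auto simp: decseq_def)
  then show ?thesis
    using that infdist_le[of u K p] by fastforce
qed

lemma orthogonal_projection_exists:
  fixes M :: "'a::{real_inner, complete_space} set"
  assumes "subspace M" "closed M"
  obtains u where "u \<in> M" "\<And>v. v \<in> M \<Longrightarrow> inner v (p - u) = 0"
proof -
  have "M \<noteq> {}"
    using subspace_0[OF \<open>subspace M\<close>] by auto
  then obtain u where u: "u \<in> M" and near: "dist p u = infdist p M"
    using nearest_point_exists[OF _ \<open>closed M\<close> subspace_imp_convex[OF \<open>subspace M\<close>]] by metis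
  have "inner v (p - u) = 0" if "v \<in> M" for v
  proof (cases "v = 0")
    case False
    \<comment> \<open>the best approximation of \<open>p - u\<close> by multiples of \<open>v\<close> must not improve on \<open>u\<close>\<close>
    define t where "t = inner v (p - u) / inner v v"
    have "u + t *\<^sub>R v \<in> M"
      using u that \<open>subspace M\<close> by (simp add: subspace_add subspace_mul)
    then have "norm (p - u) \<le> norm (p - u - t *\<^sub>R v)"
      using near infdist_le[of "u + t *\<^sub>R v" M p] by (simp add: dist_norm algebra_simps)
    then have "(norm (p - u))\<^sup>2 \<le> (norm (p - u - t *\<^sub>R v))\<^sup>2"
      by (simp add: power_mono)
    also have "\<dots> = (norm (p - u))\<^sup>2 - 2 * t * inner v (p - u) + t * t * inner v v"
      unfolding power2_norm_eq_inner
      by (simp add: inner_diff_left[of "p - u"] inner_diff_right[of _ "p - u"] inner_commute algebra_simps)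
    also have "t * t * inner v v = t * inner v (p - u)"
      using False by (simp add: t_def)
    finally have "t * inner v (p - u) \<le> 0"
      by simp
    then have "(inner v (p - u))\<^sup>2 / inner v v \<le> 0"
      by (simp add: t_def power2_eq_square)
    moreover have "inner v v > 0"
      using False by simp
    ultimately have "(inner v (p - u))\<^sup>2 \<le> 0"
      by (simp add: divide_le_0_iff)
    then show ?thesis
      by simp
  qed simp
  then show ?thesis
    using that u by blast
qed

section \<open>Weak sequential compactness\<close>

text \<open>A diagonal argument makes \<open>inner (x (r k)) z\<close> converge for every \<open>z\<close> in the range of \<open>x\<close>. The
  set of all \<open>z\<close> with this property is a closed subspace, and on its orthogonal complement all
  these inner products vanish, so it is the whole space.\<close>

lemma subsequence_inner_convergent:
  fixes x :: "nat \<Rightarrow> 'a::{real_inner, complete_space}"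
  assumes bd: "\<And>n. norm (x n) \<le> B"
  obtains r where "strict_mono r" "\<And>z. convergent (\<lambda>k. inner (x (r k)) z)"
proof -
  have "B \<ge> 0"
    using bd[of 0] norm_ge_zero[of "x 0"] by linarith
  have bdi: "\<bar>inner (x n) z\<bar> \<le> B * norm z" for n z
    using Cauchy_Schwarz_ineq2[of "x n" z] mult_right_mono[OF bd[of n] norm_ge_zero[of z]] by linarith
  have bdS: "norm (inner (x n) z) \<le> B * B" if "z \<in> range x" for n z
    using bdi[of n z] mult_left_mono[of "norm z" B B] that bd \<open>B \<ge> 0\<close> by fastforce
  have "countable (range x)"
    by simp
  then obtain r where r: "strict_mono r"
    and conv: "\<And>z. z \<in> range x \<Longrightarrow> \<exists>l. (\<lambda>k. inner (x (r k)) z) \<longlonglongrightarrow> l"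
    by (rule function_convergent_subsequence[of "range x" "\<lambda>n z. inner (x n) z" "B * B", OF _ bdS]) (assumption, rule that)
  define M where "M = {z. convergent (\<lambda>k. inner (x (r k)) z)}"
  have xM: "x n \<in> M" for n
    using conv by (auto simp: M_def convergent_def)
  have "subspace M"
    unfolding subspace_def M_def
    by (auto simp: inner_add_right convergent_const intro: convergent_add convergent_mult convergent_const)
  moreover have "closed M"
    unfolding closed_sequential_limits
  proof (intro allI impI, elim conjE)
    fix w z assume w: "\<forall>n. w n \<in> M" and lim: "w \<longlonglongrightarrow> z"
    have "Cauchy (\<lambda>k. inner (x (r k)) z)"
    proof (rule metric_CauchyI)
      fix e :: real assume "e > 0"
      have "(\<lambda>j. B * norm (z - w j)) \<longlonglongrightarrow> B * norm (z - z)"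
        by (intro tendsto_intros lim)
      then have "\<forall>\<^sub>F j in sequentially. B * norm (z - w j) < e/3"
        using \<open>e > 0\<close> by (intro order_tendstoD(2)) auto
      then obtain j where j: "B * norm (z - w j) < e/3"
        by (auto simp: eventually_sequentially)
      have near: "\<bar>inner (x n) z - inner (x n) (w j)\<bar> < e/3" for n
        using bdi[of n "z - w j"] j by (simp add: inner_diff_right)
      have "Cauchy (\<lambda>k. inner (x (r k)) (w j))"
        using w by (intro convergent_Cauchy) (auto simp: M_def)
      then obtain N where N: "\<And>m n. m \<ge> N \<Longrightarrow> n \<ge> N \<Longrightarrow>
          \<bar>inner (x (r m)) (w j) - inner (x (r n)) (w j)\<bar> < e/3"
        using metric_CauchyD[of "\<lambda>k. inner (x (r k)) (w j)" "e/3"] \<open>e > 0\<close>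
        unfolding dist_real_def by fastforce
      have "dist (inner (x (r m)) z) (inner (x (r n)) z) < e" if "m \<ge> N" "n \<ge> N" for m n
        using N[OF that] near[of "r m"] near[of "r n"] unfolding dist_real_def by linarith
      then show "\<exists>N. \<forall>m\<ge>N. \<forall>n\<ge>N. dist (inner (x (r m)) z) (inner (x (r n)) z) < e"
        by blast
    qed
    then show "z \<in> M"
      by (simp add: M_def Cauchy_convergent)
  qed
  ultimately have "p \<in> M" for p
  proof -
    obtain u where u: "u \<in> M" and orth: "\<And>v. v \<in> M \<Longrightarrow> inner v (p - u) = 0"
      using orthogonal_projection_exists[OF \<open>subspace M\<close> \<open>closed M\<close>] by metis
    have "inner (x (r k)) p = inner (x (r k)) u" for k
      using orth[OF xM] by (simp add: inner_diff_right)
    then show ?thesis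
      using u by (simp add: M_def)
  qed
  then show ?thesis
    using that r by (auto simp: M_def)
qed

text \<open>The weak limit is a point common to the closed convex hulls of all tails: once the inner
  products with \<open>z\<close> are within \<open>e\<close> of their limit, the corresponding tail, and with it its closed
  convex hull, lies in a slab of width \<open>2 * e\<close>. This produces the limit without representing the
  limit functional.\<close>

theorem bounded_weakly_convergent_subsequence:
  fixes x :: "nat \<Rightarrow> 'a::{real_inner, complete_space}"
  assumes "bounded (range x)"
  obtains r y where "strict_mono r" "weakly_converges (\<lambda>k. x (r k)) y"
proof -
  obtain B where B: "\<And>n. norm (x n) \<le> B"
    using assms by (auto simp: bounded_iff)
  obtain r where r: "strict_mono r" and conv: "\<And>z. convergent (\<lambda>k. inner (x (r k)) z)"
    by (rule subsequence_inner_convergent[of x B, OF B]) (rule that)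
  define K where "K n = closure (convex hull ((\<lambda>k. x (r k)) ` {n..}))" for n
  have inK: "x (r n) \<in> K n" for n
    unfolding K_def by (rule subsetD[OF closure_subset], rule hull_inc) auto
  have "\<exists>y. (\<forall>n. y \<in> K n) \<and> dist 0 y \<le> B"
  proof (rule nested_closed_convex_inter)
    show "decseq K"
      unfolding K_def decseq_def by (intro allI impI closure_mono hull_mono image_mono) auto
    show "infdist 0 (K n) \<le> B" for n
      using infdist_le[OF inK, of 0 n] B[of "r n"] by simp
  qed (use inK in \<open>auto simp: K_def intro: convex_closure\<close>)
  then obtain y where y: "\<And>n. y \<in> K n"
    by blast
  have "(\<lambda>k. inner (x (r k)) z) \<longlonglongrightarrow> inner y z" for z
  proof -
    obtain L where L: "(\<lambda>k. inner (x (r k)) z) \<longlonglongrightarrow> L"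
      using conv[of z] by (auto simp: convergent_def)
    have "\<bar>inner y z - L\<bar> \<le> e" if "e > 0" for e
    proof -
      obtain N where N: "\<And>k. k \<ge> N \<Longrightarrow> \<bar>inner (x (r k)) z - L\<bar> < e"
        using LIMSEQ_D[OF L \<open>e > 0\<close>] by auto
      define H where "H = {u. inner z u \<le> L + e} \<inter> {u. inner z u \<ge> L - e}"
      have "(\<lambda>k. x (r k)) ` {N..} \<subseteq> H"
        unfolding H_def by clarsimp (use N in \<open>force simp: inner_commute[of z] abs_less_iff\<close>)
      moreover have "convex H" "closed H"
        unfolding H_def by (intro convex_Int convex_halfspace_le convex_halfspace_ge
            closed_Int closed_halfspace_le closed_halfspace_ge)+
      ultimately have "K N \<subseteq> H"
        unfolding K_def by (intro closure_minimal hull_minimal)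
      then have "y \<in> H"
        using y by blast
      then show ?thesis
        by (auto simp: H_def inner_commute[of z] abs_le_iff)
    qed
    then have "\<bar>inner y z - L\<bar> \<le> 0"
      using field_le_epsilon[of "\<bar>inner y z - L\<bar>" 0] by simp
    then show ?thesis
      using L by simp
  qed
  then show ?thesis
    using that r by (auto simp: weakly_converges_def)
qed

text \<open>If \<open>inner (x k) z\<close> stayed away from \<open>inner y z\<close> along some subsequence, a weakly convergent
  subsequence of that subsequence would have a limit other than \<open>y\<close>.\<close>

lemma weakly_converges_if_unique_subsequential_limit:
  fixes x :: "nat \<Rightarrow> 'a::{real_inner, complete_space}"
  assumes bd: "bounded (range x)"
    and uniq: "\<And>r y'. strict_mono r \<Longrightarrow> weakly_converges (\<lambda>k. x (r k)) y' \<Longrightarrow> y' = y"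
  shows "weakly_converges x y"
proof (rule ccontr)
  assume "\<not> weakly_converges x y"
  then obtain z where "\<not> (\<lambda>k. inner (x k) z) \<longlonglongrightarrow> inner y z"
    by (auto simp: weakly_converges_def)
  then obtain e where "e > 0" and "\<not> (\<forall>\<^sub>F k in sequentially. dist (inner (x k) z) (inner y z) < e)"
    by (auto simp: tendsto_iff)
  then have "infinite {k. dist (inner (x k) z) (inner y z) \<ge> e}"
    by (simp add: frequently_def[symmetric] not_eventually not_less
        frequently_cofinite[symmetric] cofinite_eq_sequentially)
  then obtain r :: "nat \<Rightarrow> nat" where r: "strict_mono r"
    and far: "\<And>k. dist (inner (x (r k)) z) (inner y z) \<ge> e"
    using infinite_enumerate by blast
  have "bounded (range (\<lambda>k. x (r k)))"
    using bd by (rule bounded_subset) auto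
  then obtain s y' where s: "strict_mono s" and lim: "weakly_converges (\<lambda>k. x (r (s k))) y'"
    using bounded_weakly_convergent_subsequence by blast
  have "y' = y"
    using uniq[of "r \<circ> s" y'] lim strict_mono_o[OF r s] by (simp add: o_def)
  then have "(\<lambda>k. inner (x (r (s k))) z) \<longlonglongrightarrow> inner y z"
    using lim by (simp add: weakly_converges_def)
  then have "\<forall>\<^sub>F k in sequentially. dist (inner (x (r (s k))) z) (inner y z) < e"
    using \<open>e > 0\<close> by (rule tendstoD)
  then obtain k where "dist (inner (x (r (s k))) z) (inner y z) < e"
    by (auto simp: eventually_sequentially)
  then show False
    using far[of "s k"] by simp
qed

section \<open>Fejer monotone sequences\<close>

definition fejer_monotone :: "'a::real_normed_vector set \<Rightarrow> (nat \<Rightarrow> 'a) \<Rightarrow> bool" where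
  "fejer_monotone C x \<longleftrightarrow> (\<forall>z\<in>C. decseq (\<lambda>k. norm (x k - z)))"

lemma fejer_monotone_norm_le:
  assumes "fejer_monotone C x" "z \<in> C" "n \<le> m"
  shows "norm (x m - z) \<le> norm (x n - z)"
  using assms by (auto simp: fejer_monotone_def decseq_def)

lemma fejer_monotone_bounded:
  assumes "fejer_monotone C x" "C \<noteq> {}"
  shows "bounded (range x)"
proof -
  obtain z where "z \<in> C"
    using \<open>C \<noteq> {}\<close> by blast
  then have "dist z (x k) \<le> norm (x 0 - z)" for k
    using fejer_monotone_norm_le[OF assms(1), of z 0 k] by (simp add: dist_norm norm_minus_commute)
  then show ?thesis
    by (auto intro!: bounded_subset[OF bounded_cball[of z "norm (x 0 - z)"]])
qed

lemma fejer_monotone_norm_convergent: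
  assumes "fejer_monotone C x" "z \<in> C"
  obtains l where "(\<lambda>k. norm (x k - z)) \<longlonglongrightarrow> l"
  using decseq_convergent[of "\<lambda>k. norm (x k - z)" 0] assms unfolding fejer_monotone_def
  by (metis norm_ge_zero)

text \<open>Opial's argument: the squared norms of \<open>x k\<close> cancel in the difference of the squared distances
  to \<open>y\<close> and \<open>y'\<close>, so convergence of the distances gives convergence of \<open>inner (x k) (y - y')\<close>
  along the whole sequence. Evaluating its limit along both subsequences shows that \<open>y - y'\<close> is
  orthogonal to itself.\<close>

lemma fejer_weak_limit_unique:
  fixes x :: "nat \<Rightarrow> 'a::{real_inner, complete_space}"
  assumes fej: "fejer_monotone C x" and "y \<in> C" "y' \<in> C" "strict_mono r" "strict_mono r'"
    and lim: "weakly_converges (\<lambda>k. x (r k)) y" "weakly_converges (\<lambda>k. x (r' k)) y'"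
  shows "y = y'"
proof -
  obtain l where l: "(\<lambda>k. norm (x k - y)) \<longlonglongrightarrow> l"
    using fejer_monotone_norm_convergent[OF fej \<open>y \<in> C\<close>] by blast
  obtain l' where l': "(\<lambda>k. norm (x k - y')) \<longlonglongrightarrow> l'"
    using fejer_monotone_norm_convergent[OF fej \<open>y' \<in> C\<close>] by blast
  have "inner (x k) (y - y') =
      ((norm (x k - y'))\<^sup>2 - (norm (x k - y))\<^sup>2 + (norm y)\<^sup>2 - (norm y')\<^sup>2) / 2" for k
    unfolding power2_norm_eq_inner by (simp add: inner_diff inner_commute algebra_simps)
  moreover have "(\<lambda>k. ((norm (x k - y'))\<^sup>2 - (norm (x k - y))\<^sup>2 + (norm y)\<^sup>2 - (norm y')\<^sup>2) / 2)
      \<longlonglongrightarrow> (l'\<^sup>2 - l\<^sup>2 + (norm y)\<^sup>2 - (norm y')\<^sup>2) / 2"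
    by (intro tendsto_intros l l') auto
  ultimately obtain c where c: "(\<lambda>k. inner (x k) (y - y')) \<longlonglongrightarrow> c"
    by auto
  have "inner y (y - y') = c"
    using LIMSEQ_subseq_LIMSEQ[OF c \<open>strict_mono r\<close>] lim(1) LIMSEQ_unique
    unfolding weakly_converges_def o_def by blast
  moreover have "inner y' (y - y') = c"
    using LIMSEQ_subseq_LIMSEQ[OF c \<open>strict_mono r'\<close>] lim(2) LIMSEQ_unique
    unfolding weakly_converges_def o_def by blast
  ultimately have "inner (y - y') (y - y') = 0"
    by (simp add: inner_diff_left)
  then show ?thesis
    by simp
qed

lemma fejer_weak_limit:
  fixes x :: "nat \<Rightarrow> 'a::{real_inner, complete_space}"
  assumes fej: "fejer_monotone C x" and "C \<noteq> {}"
    and sub: "\<And>r y. strict_mono r \<Longrightarrow> weakly_converges (\<lambda>k. x (r k)) y \<Longrightarrow> y \<in> C"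
  shows "\<exists>y\<in>C. weakly_converges x y"
proof -
  note bd = fejer_monotone_bounded[OF fej \<open>C \<noteq> {}\<close>]
  obtain r y where r: "strict_mono r" and y: "weakly_converges (\<lambda>k. x (r k)) y"
    using bounded_weakly_convergent_subsequence[OF bd] by blast
  have "weakly_converges x y"
  proof (rule weakly_converges_if_unique_subsequential_limit[OF bd])
    fix s y' assume s: "strict_mono s" and y': "weakly_converges (\<lambda>k. x (s k)) y'"
    show "y' = y"
      using fejer_weak_limit_unique[OF fej sub[OF s y'] sub[OF r y] s r y' y] .
  qed
  then show ?thesis
    using sub[OF r y] by blast
qed

text \<open>Both \<open>x n\<close> and, by monotonicity, \<open>x m\<close> lie within \<open>d(x n, C)\<close> of the point of \<open>C\<close> nearest
  to \<open>x n\<close>.\<close>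

lemma fejer_dist_le_infdist:
  fixes x :: "nat \<Rightarrow> 'a::{real_inner, complete_space}"
  assumes fej: "fejer_monotone C x" and C: "C \<noteq> {}" "closed C" "convex C" and "n \<le> m"
  shows "norm (x m - x n) \<le> 2 * infdist (x n) C"
proof -
  obtain z where z: "z \<in> C" "dist (x n) z = infdist (x n) C"
    using nearest_point_exists[OF C] by metis
  have "norm (x m - x n) \<le> norm (x m - z) + norm (x n - z)"
    using norm_triangle_ineq4[of "x m - z" "x n - z"] by simp
  also have "norm (x m - z) \<le> norm (x n - z)"
    using fejer_monotone_norm_le[OF fej z(1) \<open>n \<le> m\<close>] .
  finally show ?thesis
    using z(2) by (simp add: dist_norm)
qed

lemma fejer_norm_limit:
  fixes x :: "nat \<Rightarrow> 'a::{real_inner, complete_space}"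
  assumes fej: "fejer_monotone C x" and C: "C \<noteq> {}" "closed C" "convex C"
    and lim: "(\<lambda>k. infdist (x k) C) \<longlonglongrightarrow> 0"
  obtains y where "y \<in> C" "x \<longlonglongrightarrow> y" "\<And>k. norm (x k - y) \<le> 2 * infdist (x k) C"
proof -
  note le = fejer_dist_le_infdist[OF fej C]
  have "Cauchy x"
  proof (rule metric_CauchyI)
    fix e :: real assume "e > 0"
    then have "\<forall>\<^sub>F n in sequentially. infdist (x n) C < e/4"
      by (intro order_tendstoD(2)[OF lim]) auto
    then obtain N where N: "infdist (x N) C < e/4"
      by (auto simp: eventually_sequentially)
    have "dist (x m) (x N) < e/2" if "N \<le> m" for m
      using le[OF that] N by (simp add: dist_norm)
    then have "dist (x m) (x n) < e" if "N \<le> m" "N \<le> n" for m n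
      using that by (blast intro: dist_triangle_half_r[of "x N"] dest: dist_commute_lessI)
    then show "\<exists>M. \<forall>m\<ge>M. \<forall>n\<ge>M. dist (x m) (x n) < e"
      by blast
  qed
  then obtain y where y: "x \<longlonglongrightarrow> y"
    using Cauchy_convergent convergent_def by blast
  have "(\<lambda>k. infdist (x k) C) \<longlonglongrightarrow> infdist y C"
    by (intro tendsto_infdist y)
  then have "infdist y C = 0"
    using lim LIMSEQ_unique by blast
  then have "y \<in> C"
    using in_closed_iff_infdist_zero[OF C(2,1)] by blast
  moreover have "norm (x k - y) \<le> 2 * infdist (x k) C" for k
  proof (rule LIMSEQ_le_const2)
    show "(\<lambda>m. norm (x k - x m)) \<longlonglongrightarrow> norm (x k - y)"
      by (intro tendsto_intros y)
    show "\<exists>N. \<forall>m\<ge>N. norm (x k - x m) \<le> 2 * infdist (x k) C"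
      using le by (metis norm_minus_commute)
  qed
  ultimately show ?thesis
    using that y by blast
qed

section \<open>Orbits with a strong Fejer inequality\<close>

text \<open>With \<open>z\<close> the point of \<open>C\<close> nearest to \<open>x k\<close>, the hypotheses give
  \<open>d\<^sub>k\<^sub>+\<^sub>1\<^sup>2 \<le> d\<^sub>k\<^sup>2 - r \<parallel>x (k+1) - x k\<parallel>\<^sup>2 \<le> (1 - r/\<delta>\<^sup>2) d\<^sub>k\<^sup>2\<close> for \<open>d\<^sub>k = d(x k, C)\<close>.
  Nothing forces \<open>r < \<delta>\<^sup>2\<close>, so the rate is taken to be at least \<open>1/2\<close> to keep it positive.\<close>

lemma infdist_geometric_decay:
  fixes x :: "nat \<Rightarrow> 'a::{real_inner, complete_space}"
  assumes C: "C \<noteq> {}" "closed C" "convex C" and "r > 0" "\<delta> > 0"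
    and fej: "\<And>k z. z \<in> C \<Longrightarrow>
      (norm (x (Suc k) - z))\<^sup>2 \<le> (norm (x k - z))\<^sup>2 - r * (norm (x (Suc k) - x k))\<^sup>2"
    and reg: "\<And>k. infdist (x k) C \<le> \<delta> * norm (x (Suc k) - x k)"
  obtains q where "0 < q" "q < 1" "\<And>k. infdist (x k) C \<le> infdist (x 0) C * q ^ k"
proof -
  define d where "d k = infdist (x k) C" for k
  have d0: "d k \<ge> 0" for k
    by (simp add: d_def infdist_nonneg)
  define q where "q = sqrt (max (1/4) (1 - r / \<delta>\<^sup>2))"
  have q: "0 < q" "q < 1"
    using \<open>r > 0\<close> \<open>\<delta> > 0\<close> by (auto simp: q_def)
  have q2: "1 - r / \<delta>\<^sup>2 \<le> q\<^sup>2"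
    by (simp add: q_def)
  have step: "d (Suc k) \<le> q * d k" for k
  proof -
    obtain z where z: "z \<in> C" "dist (x k) z = d k"
      using nearest_point_exists[OF C] unfolding d_def by metis
    have "d (Suc k) \<le> norm (x (Suc k) - z)"
      using infdist_le[OF z(1), of "x (Suc k)"] by (simp add: d_def dist_norm)
    then have "(d (Suc k))\<^sup>2 \<le> (norm (x (Suc k) - z))\<^sup>2"
      using d0 by (simp add: power_mono)
    also have "\<dots> \<le> (d k)\<^sup>2 - r * (norm (x (Suc k) - x k))\<^sup>2"
      using fej[OF z(1), of k] z(2) by (simp add: dist_norm)
    also have "\<dots> \<le> (d k)\<^sup>2 - r * ((d k)\<^sup>2 / \<delta>\<^sup>2)"
    proof -
      have "(d k)\<^sup>2 \<le> (\<delta> * norm (x (Suc k) - x k))\<^sup>2"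
        using reg[of k] d0[of k] unfolding d_def by (intro power_mono) auto
      then have "(d k)\<^sup>2 / \<delta>\<^sup>2 \<le> (norm (x (Suc k) - x k))\<^sup>2"
        using \<open>\<delta> > 0\<close> by (simp add: power_mult_distrib divide_le_eq mult.commute)
      then show ?thesis
        using mult_left_mono[of _ _ r] \<open>r > 0\<close> by (simp del: times_divide_eq_right)
    qed
    also have "\<dots> = (1 - r / \<delta>\<^sup>2) * (d k)\<^sup>2"
      by (simp add: algebra_simps)
    also have "\<dots> \<le> (q * d k)\<^sup>2"
      using mult_right_mono[OF q2, of "(d k)\<^sup>2"] by (simp add: power_mult_distrib)
    finally show ?thesis
      by (rule power2_le_imp_le) (use q d0 in auto)
  qed
  have "d k \<le> d 0 * q ^ k" for k
  proof (induction k)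
    case (Suc k)
    have "d (Suc k) \<le> q * (d 0 * q ^ k)"
      using step[of k] mult_left_mono[OF Suc, of q] q by linarith
    then show ?case
      by (simp add: mult_ac)
  qed simp
  then show ?thesis
    using that q unfolding d_def by blast
qed

lemma strong_fejer_imp_fejer_monotone:
  fixes x :: "nat \<Rightarrow> 'a::real_normed_vector"
  assumes "r \<ge> 0"
    and "\<And>k z. z \<in> C \<Longrightarrow>
      (norm (x (Suc k) - z))\<^sup>2 \<le> (norm (x k - z))\<^sup>2 - r * (norm (x (Suc k) - x k))\<^sup>2"
  shows "fejer_monotone C x"
  unfolding fejer_monotone_def
proof (intro ballI decseq_SucI)
  fix z k assume "z \<in> C"
  have "r * (norm (x (Suc k) - x k))\<^sup>2 \<ge> 0"
    using \<open>r \<ge> 0\<close> by simp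
  then have "(norm (x (Suc k) - z))\<^sup>2 \<le> (norm (x k - z))\<^sup>2"
    using assms(2)[OF \<open>z \<in> C\<close>, of k] by linarith
  then show "norm (x (Suc k) - z) \<le> norm (x k - z)"
    by (rule power2_le_imp_le) simp
qed

text \<open>Each squared step is at most a constant times the decrease of \<open>\<parallel>x k - z\<parallel>\<^sup>2\<close>, a convergent
  sequence.\<close>

lemma strong_fejer_steps_tendsto_zero:
  fixes x :: "nat \<Rightarrow> 'a::real_normed_vector"
  assumes "C \<noteq> {}" "r > 0"
    and fej: "\<And>k z. z \<in> C \<Longrightarrow>
      (norm (x (Suc k) - z))\<^sup>2 \<le> (norm (x k - z))\<^sup>2 - r * (norm (x (Suc k) - x k))\<^sup>2"
  shows "(\<lambda>k. norm (x (Suc k) - x k)) \<longlonglongrightarrow> 0"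
proof -
  obtain z where z: "z \<in> C"
    using \<open>C \<noteq> {}\<close> by blast
  have "fejer_monotone C x"
    using strong_fejer_imp_fejer_monotone[of r C x, OF _ fej] \<open>r > 0\<close> by simp
  then obtain l where l: "(\<lambda>k. norm (x k - z)) \<longlonglongrightarrow> l"
    using fejer_monotone_norm_convergent z by blast
  have "(\<lambda>k. ((norm (x k - z))\<^sup>2 - (norm (x (Suc k) - z))\<^sup>2) / r) \<longlonglongrightarrow> (l\<^sup>2 - l\<^sup>2) / r"
    using \<open>r > 0\<close> by (intro tendsto_intros l LIMSEQ_Suc[OF l]) auto
  then have lim: "(\<lambda>k. ((norm (x k - z))\<^sup>2 - (norm (x (Suc k) - z))\<^sup>2) / r) \<longlonglongrightarrow> 0"
    by simp
  have "(\<lambda>k. (norm (x (Suc k) - x k))\<^sup>2) \<longlonglongrightarrow> 0"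
  proof (rule tendsto_sandwich[OF _ _ tendsto_const lim])
    show "\<forall>\<^sub>F k in sequentially. (norm (x (Suc k) - x k))\<^sup>2
        \<le> ((norm (x k - z))\<^sup>2 - (norm (x (Suc k) - z))\<^sup>2) / r"
      using fej[OF z] \<open>r > 0\<close> by (intro always_eventually allI) (simp add: le_divide_eq algebra_simps)
  qed simp
  then show ?thesis
    using tendsto_real_sqrt by fastforce
qed

lemma boundedly_linearly_regular_imp_boundedly_regular:
  assumes "boundedly_linearly_regular D V"
  shows "boundedly_regular D V"
  unfolding boundedly_regular_def
proof (intro conjI allI impI)
  show "regularity_setting D V"
    using assms by (simp add: boundedly_linearly_regular_def)
  fix x :: "nat \<Rightarrow> 'a"
  assume "bounded (range x)" and lim: "(\<lambda>k. norm (V k (x k) - x k)) \<longlonglongrightarrow> 0"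
  then obtain \<delta> where "\<And>k. infdist (x k) D \<le> \<delta> * norm (V k (x k) - x k)"
    using assms unfolding boundedly_linearly_regular_def
    by (metis (no_types, lifting) empty_not_UNIV image_is_empty rangeI)
  then have "\<forall>\<^sub>F k in sequentially. norm (infdist (x k) D) \<le> \<delta> * norm (V k (x k) - x k)"
    by (simp add: infdist_nonneg)
  moreover have "(\<lambda>k. \<delta> * norm (V k (x k) - x k)) \<longlonglongrightarrow> 0"
    using tendsto_mult_left[OF lim, of \<delta>] by simp
  ultimately show "(\<lambda>k. infdist (x k) D) \<longlonglongrightarrow> 0"
    by (rule Lim_null_comparison)
qed

theorem theorem6p1:
  fixes C :: "'a::{real_inner, complete_space} set"
    and U :: "nat \<Rightarrow> 'a \<Rightarrow> 'a"
    and \<rho> :: "nat \<Rightarrow> real"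
    and x :: "nat \<Rightarrow> 'a"
  assumes "C \<noteq> {}" and "closed C" and "convex C"
    and "\<And>k. strongly_quasi_nonexpansive (\<rho> k) (U k)"
    and "(INF k. \<rho> k) > 0"
    and "C \<subseteq> (\<Inter>k. Fix (U k))"
    and "\<And>k. x (Suc k) = U k (x k)"
  shows
    "(weakly_regular C U \<longrightarrow> (\<exists>xs\<in>C. weakly_converges x xs)) \<and>
     (boundedly_regular C U \<longrightarrow> (\<exists>xs\<in>C. x \<longlonglongrightarrow> xs)) \<and>
     (boundedly_linearly_regular C U \<longrightarrow>
        (\<exists>xs\<in>C. \<exists>q. 0 < q \<and> q < 1 \<and>
           (\<forall>k. norm (x k - xs) \<le> 2 * infdist (x 0) C * q ^ k)))"
proof -
  note C = assms(1-3)
  define r where "r = (INF k. \<rho> k)"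
  have "r > 0"
    using assms(5) by (simp add: r_def)
  have r_le: "r \<le> \<rho> k" for k
    unfolding r_def using assms(4)
    by (intro cINF_lower bdd_belowI[of _ 0]) (auto simp: strongly_quasi_nonexpansive_def)
  have strong: "(norm (x (Suc k) - z))\<^sup>2 \<le> (norm (x k - z))\<^sup>2 - r * (norm (x (Suc k) - x k))\<^sup>2"
    if "z \<in> C" for k z
  proof -
    have "z \<in> Fix (U k)"
      using assms(6) that by blast
    then have "(norm (x (Suc k) - z))\<^sup>2 \<le> (norm (x k - z))\<^sup>2 - \<rho> k * (norm (x (Suc k) - x k))\<^sup>2"
      using assms(4)[of k] by (simp add: strongly_quasi_nonexpansive_def assms(7))
    then show ?thesis
      using mult_right_mono[OF r_le[of k], of "(norm (x (Suc k) - x k))\<^sup>2"] by simp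
  qed
  have fej: "fejer_monotone C x"
    using strong_fejer_imp_fejer_monotone[of r C x, OF _ strong] \<open>r > 0\<close> by simp
  note bd = fejer_monotone_bounded[OF fej C(1)]
  have steps: "(\<lambda>k. norm (U k (x k) - x k)) \<longlonglongrightarrow> 0"
    using strong_fejer_steps_tendsto_zero[of C r x, OF C(1) \<open>r > 0\<close> strong] by (simp add: assms(7))
  have dist0: "(\<lambda>k. infdist (x k) C) \<longlonglongrightarrow> 0" if "boundedly_regular C U"
    using that bd steps by (simp add: boundedly_regular_def)
  show ?thesis
  proof (intro conjI impI)
    assume reg: "weakly_regular C U"
    show "\<exists>xs\<in>C. weakly_converges x xs"
    proof (rule fejer_weak_limit[OF fej C(1)])
      show "y \<in> C" if "strict_mono n" "weakly_converges (\<lambda>k. x (n k)) y" for n y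
        using reg that steps unfolding weakly_regular_def by blast
    qed
  next
    assume "boundedly_regular C U"
    from fejer_norm_limit[OF fej C dist0[OF this]] show "\<exists>xs\<in>C. x \<longlonglongrightarrow> xs"
      by metis
  next
    assume reg: "boundedly_linearly_regular C U"
    obtain xs where xs: "xs \<in> C" "\<And>k. norm (x k - xs) \<le> 2 * infdist (x k) C"
      using fejer_norm_limit[OF fej C dist0[OF boundedly_linearly_regular_imp_boundedly_regular[OF reg]]]
      by metis
    obtain \<delta> where "\<delta> > 0" and \<delta>: "\<forall>u\<in>range x. \<forall>k. infdist u C \<le> \<delta> * norm (U k u - u)"
      using reg bd unfolding boundedly_linearly_regular_def by (metis empty_not_UNIV image_is_empty)
    have "infdist (x k) C \<le> \<delta> * norm (x (Suc k) - x k)" for k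
      using \<delta> by (simp add: assms(7))
    from infdist_geometric_decay[of C r \<delta> x, OF C \<open>r > 0\<close> \<open>\<delta> > 0\<close> strong this]
    obtain q where q: "0 < q" "q < 1" "\<And>k. infdist (x k) C \<le> infdist (x 0) C * q ^ k"
      by metis
    have "norm (x k - xs) \<le> 2 * infdist (x 0) C * q ^ k" for k
      using xs(2)[of k] q(3)[of k] by linarith
    then show "\<exists>xs\<in>C. \<exists>q. 0 < q \<and> q < 1 \<and> (\<forall>k. norm (x k - xs) \<le> 2 * infdist (x 0) C * q ^ k)"
      using xs(1) q(1,2) by blast
  qed
qed

end
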